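(* If $f,g\in XDBP$, then $f\circ g\in XDBP$. Moreover, for $f,g\in XDBP$, $$\mathbf{D}_{f^{\circ 2}}\simeq\mathbf{D}_{g^{\circ 2}}\iff f=g .$$ Thus the map $XDBP\to[BP]$ given by $f\mapsto[f^{\circ 2}]$ is injective and $\Gamma$-equivariant, where $\Gamma=\mathrm{Gal}(\overline{\mathbb{Q}}/\mathbb{Q})$.
   Context: Fix an embedding $\overline{\mathbb{Q}}\subset\mathbb{C}$. For a polynomial $f$, $C_f$ is its set of critical points in $\mathbb{C}$ and $P_f=\overline{\bigcup_{n>0}f^{\circ n}(C_f)}$, where $f^{\circ n}$ is the $n$-th iterate. A (clean) Belyi polynomial is a polynomial $f\in\overline{\mathbb{Q}}[z]$ of degree at least $3$ all of whose critical values lie in $\{0,1\}$ and which has local degree exactly $2$ at every point of $f^{-1}(1)$. $DBP$ is the set of Belyi polynomials with $P_f\subset\{0,1\}$. $XDBP$ is the set of $f\in DBP$ with $f(0)=f(1)=0$ and local degree of $f$ equal to one at both $0$ and $1$. Two Belyi polynomials $f,g$ are isomorphic if $f=g\circ A$ for some affine map $A(z)=az+b$, $a\neq0$; $[BP]$ is the set of isomorphism classes and $[f]$ is the class of $f$. The dessin $\mathbf{D}_f$ is the planar tree $f^{-1}([0,1])$ with black vertices $f^{-1}(0)$, white vertices $f^{-1}(1)$, and edges the closures of the components of $f^{-1}((0,1))$; $\mathbf{D}_f\simeq\mathbf{D}_g$ means there is an orientation-preserving homeomorphism of the plane (or sphere) carrying $\mathbf{D}_f$ to $\mathbf{D}_g$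 as trees and preserving colors. By the Grothendieck correspondence (known, may be assumed), $\mathbf{D}_f\simeq\mathbf{D}_g$ if and only if $[f]=[g]$. $\Gamma$ acts on polynomials by applying $\sigma\in\Gamma$ to coefficients, $f\mapsto f^\sigma$; this preserves $XDBP$ and descends to $[BP]$ by $\sigma\cdot[f]=[f^\sigma]$. *)

theory Defs
  imports "HOL-Complex_Analysis.Complex_Analysis"
begin

definition crit_points :: "complex poly \<Rightarrow> complex set" where
  "crit_points f = {z. poly (pderiv f) z = 0}"

definition postcritical_set :: "complex poly \<Rightarrow> complex set" where
  "postcritical_set f = closure (\<Union>n\<in>{n. n > 0}. (poly f ^^ n) ` crit_points f)"

definition local_degree :: "complex poly \<Rightarrow> complex \<Rightarrow> nat" where
  "local_degree f z = order z (f - [:poly f z:])"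

text \<open>Belyi polynomials are always clean here. The field of algebraic numbers inside the
  complex numbers is the set of all \<open>z\<close> with \<^term>\<open>algebraic z\<close>.\<close>

definition BP :: "complex poly set" where
  "BP = {f. (\<forall>i. algebraic (coeff f i)) \<and> degree f \<ge> 3 \<and>
            poly f ` crit_points f \<subseteq> {0, 1} \<and>
            (\<forall>z. poly f z = 1 \<longrightarrow> local_degree f z = 2)}"

definition DBP :: "complex poly set" where
  "DBP = {f \<in> BP. postcritical_set f \<subseteq> {0, 1}}"

definition XDBP :: "complex poly set" where
  "XDBP = {f \<in> DBP. poly f 0 = 0 \<and> poly f 1 = 0 \<and> local_degree f 0 = 1 \<and> local_degree f 1 = 1}"

definition bp_rel :: "(complex poly \<times> complex poly) set" where
  "bp_rel = {(f, g). f \<in> BP \<and> g \<in> BP \<and> (\<exists>a b. a \<noteq> 0 \<and> f = g \<circ>\<^sub>p [:b, a:])}"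

definition bp_class :: "complex poly \<Rightarrow> complex poly set" where
  "bp_class f = bp_rel `` {f}"

record plane_tree =
  support :: "complex set"
  black :: "complex set"
  white :: "complex set"
  edges :: "complex set set"

definition dessin :: "complex poly \<Rightarrow> plane_tree" where
  "dessin f = \<lparr>support = poly f -` closed_segment 0 1,
               black = poly f -` {0},
               white = poly f -` {1},
               edges = closure ` components (poly f -` open_segment 0 1)\<rparr>"

text \<open>A homeomorphism \<open>h\<close> of the plane preserves the orientation iff it maps positively oriented
  circles to loops of winding number 1 about the image of the centre, that is, iff its local
  degree is 1; no differentiability is required. The library's winding number is defined for
  every continuous loop.\<close>

definition plane_homeo_op :: "(complex \<Rightarrow> complex) \<Rightarrow> bool" where
  "plane_homeo_op h \<longleftrightarrow> (\<exists>k. homeomorphism UNIV UNIV h k) \<and>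
     (\<forall>z r. r > 0 \<longrightarrow> winding_number (h \<circ> circlepath z r) (h z) = 1)"

definition tree_iso :: "plane_tree \<Rightarrow> plane_tree \<Rightarrow> bool"  (infix \<open>\<simeq>\<^sub>D\<close> 50) where
  "S \<simeq>\<^sub>D T \<longleftrightarrow> (\<exists>h. plane_homeo_op h \<and>
     h ` support S = support T \<and> h ` black S = black T \<and> h ` white S = white T \<and>
     (`) h ` edges S = edges T)"

text \<open>The absolute Galois group of the rationals: field automorphisms of the algebraic numbers.
  They fix the rationals automatically; outside the algebraic numbers the functions are
  \<^term>\<open>undefined\<close>, so that distinct functions are distinct automorphisms.\<close>

definition Gal_Qbar :: "(complex \<Rightarrow> complex) set" where
  "Gal_Qbar = {\<sigma> \<in> extensional {z. algebraic z}.
     bij_betw \<sigma> {z. algebraic z} {z. algebraic z} \<and>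
     (\<forall>x y. algebraic x \<longrightarrow> algebraic y \<longrightarrow> \<sigma> (x + y) = \<sigma> x + \<sigma> y \<and> \<sigma> (x * y) = \<sigma> x * \<sigma> y)}"

definition gal_poly :: "(complex \<Rightarrow> complex) \<Rightarrow> complex poly \<Rightarrow> complex poly" where
  "gal_poly \<sigma> f = map_poly \<sigma> f"

text \<open>The action induced on classes, lifted from representatives in the manner of
  \<^theory>\<open>HOL.Equiv_Relations\<close>.\<close>

definition gal_class :: "(complex \<Rightarrow> complex) \<Rightarrow> complex poly set \<Rightarrow> complex poly set" where
  "gal_class \<sigma> c = (\<Union>f\<in>c. bp_class (gal_poly \<sigma> f))"

end

theory Submission
  imports Defs "HOL-Computational_Algebra.Fundamental_Theorem_Algebra"
begin

text \<open>If \<open>f \<circ> f = g \<circ> g \<circ> A\<close> with \<open>A\<close> affine, uniqueness of polynomial decompositions gives an affine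
  \<open>B\<close> with \<open>f = g \<circ> B\<close> and \<open>B \<circ> f = g \<circ> A\<close>. Both 0 and 1 are critical values of \<open>f\<close>, so \<open>B\<close> permutes
  \<open>{0, 1}\<close>, and it does not exchange them: all points of \<open>f\<close> over 1 are critical, while \<open>g\<close> is
  unramified at 0, which lies over 0. Hence \<open>B\<close> is the identity.

  Galois conjugation acts on the critical points themselves, because the roots of polynomials with
  algebraic coefficients are algebraic. This holds since \<open>z\<close> is algebraic iff multiplication by
  \<open>z\<close> preserves a finite-dimensional rational space containing 1.\<close>

subsection \<open>Algebraic numbers\<close>

global_interpretation rat_vs: vector_space "\<lambda>(q::rat) (x::'a::field_char_0). of_rat q * x"
  by unfold_locales (simp_all add: algebra_simps of_rat_add of_rat_mult)

text \<open>For finite \<open>B\<close> containing 1 this is a ring of algebraic numbers, and every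
  finite set of algebraic numbers lies in such a ring. Closure of the algebraic numbers under ring
  operations and roots thus becomes linear algebra over the rationals.\<close>

definition stabilizer :: "'a::field_char_0 set \<Rightarrow> 'a set" where
  "stabilizer B = {x. \<forall>b\<in>B. x * b \<in> rat_vs.span B}"

lemma stabilizer_span:
  assumes "x \<in> stabilizer B" "v \<in> rat_vs.span B"
  shows "x * v \<in> rat_vs.span B"
  using assms(2)
proof (induction rule: rat_vs.span_induct_alt)
  case base
  then show ?case by (simp add: rat_vs.span_zero)
next
  case (step c b v)
  have "of_rat c * (x * b) + x * v \<in> rat_vs.span B"
    using assms(1) step by (intro rat_vs.span_add rat_vs.span_scale) (auto simp: stabilizer_def)
  then show ?case by (simp add: algebra_simps)
qed

lemma stabilizer_add: "x \<in> stabilizer B \<Longrightarrow> y \<in> stabilizer B \<Longrightarrow> x + y \<in> stabilizer B"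
  by (auto simp: stabilizer_def distrib_right intro: rat_vs.span_add)

lemma stabilizer_mult: "x \<in> stabilizer B \<Longrightarrow> y \<in> stabilizer B \<Longrightarrow> x * y \<in> stabilizer B"
  using stabilizer_span[of x B] by (auto simp: stabilizer_def mult.assoc)

lemma stabilizer_of_rat: "of_rat q \<in> stabilizer B"
  by (auto simp: stabilizer_def intro: rat_vs.span_scale rat_vs.span_base)

text \<open>\<open>B'\<close> spans the products of the span of \<open>B\<close> with the powers of
  \<open>z\<close> below \<open>n\<close>. Multiplication by \<open>z\<close> raises the exponent,
  and \<open>z ^ n\<close> is reduced by the monic equation, whose coefficients preserve the span of
  \<open>B\<close>.\<close>

lemma stabilizer_adjoin_root:
  fixes p :: "'a::field_char_0 poly"
  assumes "finite B" "1 \<in> B" and monic: "lead_coeff p = 1" and root: "poly p z = 0"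
    and coeffs: "\<And>i. coeff p i \<in> stabilizer B"
  obtains B' where "finite B'" "1 \<in> B'" "stabilizer B \<subseteq> stabilizer B'" "z \<in> stabilizer B'"
proof -
  define n where "n = degree p"
  define B' where "B' = (\<lambda>(b, j). b * z ^ j) ` (B \<times> {..<n})"
  \<comment> \<open>A monic constant is 1 and has no root. With \<open>n = 0\<close> the set
    \<open>B'\<close> would be empty and miss 1.\<close>
  have "n > 0"
  proof (rule ccontr)
    assume "\<not> n > 0"
    then obtain a where "p = [:a:]" using degree_eq_zeroE[of p] by (auto simp: n_def)
    with monic root show False by simp
  qed
  have mem: "b * z ^ j \<in> B'" if "b \<in> B" "j < n" for b j
    using that by (auto simp: B'_def intro!: image_eqI[of _ _ "(b, j)"])
  have span: "v * z ^ j \<in> rat_vs.span B'" if "v \<in> rat_vs.span B" "j < n" for v j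
    using that(1)
  proof (induction rule: rat_vs.span_induct_alt)
    case base
    then show ?case by (simp add: rat_vs.span_zero)
  next
    case (step c b v)
    have "of_rat c * (b * z ^ j) + v * z ^ j \<in> rat_vs.span B'"
      using step that(2) mem by (intro rat_vs.span_add rat_vs.span_scale) (auto intro: rat_vs.span_base)
    then show ?case by (simp add: algebra_simps)
  qed
  show thesis
  proof
    show "finite B'" using assms(1) by (simp add: B'_def)
    show "1 \<in> B'" using mem[OF assms(2) \<open>n > 0\<close>] by simp
    show "stabilizer B \<subseteq> stabilizer B'"
    proof
      fix x assume "x \<in> stabilizer B"
      then have "x * b * z ^ j \<in> rat_vs.span B'" if "b \<in> B" "j < n" for b j
        using that by (intro span) (auto simp: stabilizer_def)
      then show "x \<in> stabilizer B'" by (auto simp: stabilizer_def B'_def mult.assoc)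
    qed
    have "z * (b * z ^ j) \<in> rat_vs.span B'" if "b \<in> B" "j < n" for b j
    proof (cases "Suc j < n")
      case True
      have "b * z ^ Suc j \<in> rat_vs.span B'" using mem[OF that(1) True] by (rule rat_vs.span_base)
      then show ?thesis by (simp add: mult_ac)
    next
      case False
      then have n: "n = Suc j" using that by simp
      have "0 = (\<Sum>i<n. coeff p i * z ^ i) + z ^ n"
        using root monic by (simp add: poly_altdef n_def flip: lessThan_Suc_atMost)
      then have zn: "z ^ n = - (\<Sum>i<n. coeff p i * z ^ i)" by (simp add: eq_neg_iff_add_eq_0 add.commute)
      have "z * (b * z ^ j) = b * z ^ n" by (simp add: n mult_ac)
      also have "\<dots> = - (\<Sum>i<n. (coeff p i * b) * z ^ i)"
        unfolding zn by (simp add: sum_distrib_left mult_ac)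
      finally have "z * (b * z ^ j) = - (\<Sum>i<n. (coeff p i * b) * z ^ i)" .
      moreover have "(\<Sum>i<n. (coeff p i * b) * z ^ i) \<in> rat_vs.span B'"
        using coeffs that(1) by (intro rat_vs.span_sum span) (auto simp: stabilizer_def)
      ultimately show ?thesis by (simp add: rat_vs.span_neg)
    qed
    then show "z \<in> stabilizer B'" by (auto simp: stabilizer_def B'_def)
  qed
qed

text \<open>Starting from \<open>{1}\<close>, the elements are adjoined one at a time. Each
  satisfies a monic rational equation, and rational numbers belong to every stabilizer.\<close>

lemma finite_algebraic_stabilizer:
  assumes "finite X" "\<And>x. x \<in> X \<Longrightarrow> algebraic x"
  obtains B where "finite B" "1 \<in> B" "X \<subseteq> stabilizer B"
proof -
  have "\<exists>B. finite B \<and> 1 \<in> B \<and> X \<subseteq> stabilizer B"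
    using assms
  proof (induction rule: finite_induct)
    case empty
    show ?case by (rule exI[of _ "{1}"]) auto
  next
    case (insert y X)
    then obtain B where B: "finite B" "1 \<in> B" "X \<subseteq> stabilizer B" by auto
    from insert.prems have "algebraic y" by simp
    then obtain p where p: "\<And>i. coeff p i \<in> \<rat>" "p \<noteq> 0" "poly p y = 0"
      unfolding algebraic_altdef by blast
    let ?q = "smult (inverse (lead_coeff p)) p"
    have "coeff ?q i \<in> \<rat>" for i using p by simp
    then have "coeff ?q i \<in> stabilizer B" for i by (metis Rats_cases stabilizer_of_rat)
    moreover have "lead_coeff ?q = 1" "poly ?q y = 0" using p by auto
    ultimately obtain B' where "finite B'" "1 \<in> B'" "stabilizer B \<subseteq> stabilizer B'" "y \<in> stabilizer B'"
      using B(1,2) stabilizer_adjoin_root by metis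
    with B(3) show ?case by blast
  qed
  then show thesis using that by blast
qed

text \<open>All powers of \<open>z\<close> lie in the span of \<open>B\<close>, whose dimension is
  at most \<open>card B\<close>, so \<open>card B + 1\<close> of them satisfy a nontrivial rational
  relation.\<close>

lemma algebraic_stabilizer:
  assumes "finite B" "1 \<in> B" "z \<in> stabilizer B"
  shows "algebraic z"
proof -
  have pow: "z ^ k \<in> rat_vs.span B" for k
    by (induction k) (simp_all add: rat_vs.span_base assms(2) stabilizer_span[OF assms(3)])
  let ?f = "\<lambda>k. z ^ k" and ?n = "card B"
  show ?thesis
  proof (cases "inj_on ?f {..?n}")
    case True
    let ?S = "?f ` {..?n}"
    have "card ?S = Suc ?n" using True by (simp add: card_image)
    then have "rat_vs.dependent ?S"
      using rat_vs.independent_span_bound[OF assms(1), of ?S] pow by auto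
    then obtain u where u: "\<exists>v\<in>?S. u v \<noteq> 0" "(\<Sum>v\<in>?S. of_rat (u v) * v) = 0"
      by (auto simp: rat_vs.dependent_finite)
    define p where "p = (\<Sum>k\<le>?n. monom (of_rat (u (z ^ k)) :: 'a) k)"
    have c: "coeff p i = (if i \<le> ?n then of_rat (u (z ^ i)) else 0)" for i
      by (auto simp: p_def coeff_sum)
    show ?thesis
    proof (rule algebraicI')
      show "coeff p i \<in> \<rat>" for i by (simp add: c)
      from u(1) obtain k where "k \<le> ?n" "u (z ^ k) \<noteq> 0" by auto
      then have "coeff p k \<noteq> 0" by (simp add: c)
      then show "p \<noteq> 0" by auto
      show "poly p z = 0"
        using u(2) True by (simp add: p_def poly_sum poly_monom sum.reindex)
    qed
  next
    \<comment> \<open>Dependence of a set does not see repeated powers; a repetition gives the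
      equation \<open>z ^ i = z ^ j\<close> directly.\<close>
    case False
    then obtain i j where ij: "i \<noteq> j" "z ^ i = z ^ j" by (auto simp: inj_on_def)
    show ?thesis
    proof (rule algebraicI')
      let ?p = "monom 1 i - monom 1 j :: 'a poly"
      show "coeff ?p k \<in> \<rat>" for k by simp
      have "coeff ?p i \<noteq> 0" using ij(1) by simp
      then show "?p \<noteq> 0" by fastforce
      show "poly ?p z = 0" using ij(2) by (simp add: poly_monom)
    qed
  qed
qed

lemma algebraic_add:
  assumes "algebraic x" "algebraic y"
  shows "algebraic (x + y)"
proof -
  obtain B where "finite B" "1 \<in> B" "{x, y} \<subseteq> stabilizer B"
    by (rule finite_algebraic_stabilizer[of "{x, y}"]) (use assms in auto)
  then show ?thesis
    by (intro algebraic_stabilizer[of B] stabilizer_add) simp_all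
qed

lemma algebraic_mult:
  assumes "algebraic x" "algebraic y"
  shows "algebraic (x * y)"
proof -
  obtain B where "finite B" "1 \<in> B" "{x, y} \<subseteq> stabilizer B"
    by (rule finite_algebraic_stabilizer[of "{x, y}"]) (use assms in auto)
  then show ?thesis
    by (intro algebraic_stabilizer[of B] stabilizer_mult) simp_all
qed

lemma algebraic_of_nat: "algebraic (of_nat n)"
  by (simp add: rat_imp_algebraic)

lemma algebraic_sum: "(\<And>i. i \<in> A \<Longrightarrow> algebraic (f i)) \<Longrightarrow> algebraic (\<Sum>i\<in>A. f i)"
  by (induction A rule: infinite_finite_induct) (auto intro: algebraic_add)

text \<open>The finitely many coefficients share one stabilizer, and adjoining \<open>z\<close> as a
  root of the monic multiple enlarges it to one that contains \<open>z\<close>.\<close>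

lemma algebraic_root_of_algebraic_poly:
  fixes p :: "'a::field_char_0 poly"
  assumes "\<And>i. algebraic (coeff p i)" "p \<noteq> 0" "poly p z = 0"
  shows "algebraic z"
proof -
  let ?q = "smult (inverse (lead_coeff p)) p"
  have "finite (range (coeff p))"
  proof (rule finite_subset)
    show "range (coeff p) \<subseteq> insert 0 (coeff p ` {..degree p})"
    proof safe
      fix i assume "coeff p i \<notin> coeff p ` {..degree p}"
      then show "coeff p i = 0" by (intro coeff_eq_0) (meson atMost_iff imageI not_le)
    qed
  qed simp
  then have "finite (range (coeff ?q))"
    using finite_imageI[of "range (coeff p)" "\<lambda>c. inverse (lead_coeff p) * c"]
    by (simp add: image_image)
  moreover have "algebraic (coeff ?q i)" for i
    using assms(1) by (simp add: algebraic_mult algebraic_inverse)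
  ultimately obtain B where B: "finite B" "1 \<in> B" "range (coeff ?q) \<subseteq> stabilizer B"
    using finite_algebraic_stabilizer[of "range (coeff ?q)"] by (metis rangeE)
  have q: "lead_coeff ?q = 1" "poly ?q z = 0" using assms by auto
  have coeff: "coeff ?q i \<in> stabilizer B" for i using B(3) by blast
  show ?thesis
  proof (rule stabilizer_adjoin_root[OF B(1,2) q coeff])
    fix B' assume "finite B'" "1 \<in> B'" "z \<in> stabilizer B'"
    then show "algebraic z" by (rule algebraic_stabilizer)
  qed
qed

section \<open>Polynomials with algebraic coefficients\<close>

definition algebraic_poly :: "'a::field_char_0 poly \<Rightarrow> bool" where
  "algebraic_poly p \<longleftrightarrow> (\<forall>i. algebraic (coeff p i))"

lemma algebraic_poly_0: "algebraic_poly 0"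
  by (simp add: algebraic_poly_def)

lemma algebraic_poly_pCons: "algebraic_poly (pCons a p) \<longleftrightarrow> algebraic a \<and> algebraic_poly p"
  by (auto simp: algebraic_poly_def coeff_pCons split: nat.splits dest: spec[of _ 0] spec[of _ "Suc _"])

lemma algebraic_poly_add: "algebraic_poly p \<Longrightarrow> algebraic_poly q \<Longrightarrow> algebraic_poly (p + q)"
  by (auto simp: algebraic_poly_def intro: algebraic_add)

lemma algebraic_poly_mult: "algebraic_poly p \<Longrightarrow> algebraic_poly q \<Longrightarrow> algebraic_poly (p * q)"
  by (auto simp: algebraic_poly_def coeff_mult intro!: algebraic_sum algebraic_mult)

lemma algebraic_poly_pcompose: "algebraic_poly p \<Longrightarrow> algebraic_poly q \<Longrightarrow> algebraic_poly (p \<circ>\<^sub>p q)"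
  by (induction p)
    (auto simp: pcompose_pCons algebraic_poly_pCons
      intro!: algebraic_poly_add algebraic_poly_mult algebraic_poly_0)

lemma algebraic_poly_pderiv: "algebraic_poly p \<Longrightarrow> algebraic_poly (pderiv p)"
  unfolding algebraic_poly_def coeff_pderiv by (intro allI algebraic_mult algebraic_of_nat) auto

lemma algebraic_poly_eval: "algebraic_poly p \<Longrightarrow> algebraic x \<Longrightarrow> algebraic (poly p x)"
  by (induction p) (auto simp: algebraic_poly_pCons intro: algebraic_add algebraic_mult)

text \<open>The polynomial \<open>p\<close> minus the constant \<open>poly p z\<close> has algebraic
  coefficients and the root \<open>z\<close>, and positive degree keeps it nonzero.\<close>

lemma algebraic_poly_preimage:
  assumes "algebraic_poly p" "degree p > 0" "algebraic (poly p z)"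
  shows "algebraic z"
proof (rule algebraic_root_of_algebraic_poly)
  let ?q = "p + [:- poly p z:]"
  have "algebraic_poly ?q" using assms by (intro algebraic_poly_add) (auto simp: algebraic_poly_pCons algebraic_poly_0)
  then show "algebraic (coeff ?q i)" for i by (simp only: algebraic_poly_def)
  have "degree ?q = degree p" using assms(2) by (intro degree_add_eq_left) auto
  then show "?q \<noteq> 0" using assms(2) by auto
  show "poly ?q z = 0" by simp
qed

subsection \<open>Belyi polynomials\<close>

lemma local_degree_eq_Suc:
  assumes "degree f > 0"
  shows "local_degree f z = Suc (order z (pderiv f))"
proof -
  let ?p = "f - [:poly f z:]"
  have "?p \<noteq> 0" using assms by (metis degree_pCons_0 eq_iff_diff_eq_0 less_irrefl)
  then show ?thesis unfolding local_degree_def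
    by (subst order_pderiv) (auto simp: pderiv_diff)
qed

lemma local_degree_eq_1_iff:
  assumes "degree f > 0"
  shows "local_degree f z = 1 \<longleftrightarrow> poly (pderiv f) z \<noteq> 0"
  using assms by (auto simp: local_degree_eq_Suc order_root pderiv_eq_0_iff)

lemma local_degree_eq_2_iff:
  assumes "degree f > 0"
  shows "local_degree f z = 2 \<longleftrightarrow> poly (pderiv f) z = 0 \<and> poly (pderiv (pderiv f)) z \<noteq> 0"
proof (cases "poly (pderiv f) z = 0")
  case True
  have nz: "pderiv f \<noteq> 0" using assms by (simp add: pderiv_eq_0_iff)
  \<comment> \<open>A constant derivative with the root \<open>z\<close> would be 0, against
    \<open>nz\<close>. Hence the second derivative is not the zero polynomial and its order at
    \<open>z\<close> detects vanishing.\<close>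
  have "degree (pderiv f) > 0"
  proof (rule ccontr)
    assume "\<not> degree (pderiv f) > 0"
    then obtain a where "pderiv f = [:a:]" using degree_eq_zeroE[of "pderiv f"] by auto
    with True nz show False by simp
  qed
  then have "pderiv (pderiv f) \<noteq> 0" by (simp add: pderiv_eq_0_iff)
  then show ?thesis
    using True assms order_pderiv[OF nz True]
    by (auto simp: local_degree_eq_Suc order_eq_0_iff)
next
  case False
  then show ?thesis using assms by (simp add: local_degree_eq_Suc order_0I)
qed

text \<open>Local degrees are traded for derivatives, which obey the chain rule and commute with
  conjugation of coefficients.\<close>

lemma BP_iff:
  "f \<in> BP \<longleftrightarrow> algebraic_poly f \<and> degree f \<ge> 3 \<and>
     (\<forall>z. poly (pderiv f) z = 0 \<longrightarrow> poly f z \<in> {0, 1}) \<and>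
     (\<forall>z. poly f z = 1 \<longrightarrow> poly (pderiv f) z = 0 \<and> poly (pderiv (pderiv f)) z \<noteq> 0)"
  by (cases "degree f \<ge> 3")
    (auto simp: BP_def crit_points_def algebraic_poly_def local_degree_eq_2_iff image_subset_iff)

text \<open>Critical values lie in the closed set \<open>{0, 1}\<close>, which \<open>f\<close> maps
  into itself.\<close>

lemma postcritical_set_subset:
  assumes "f \<in> BP" "poly f 0 \<in> {0, 1}" "poly f 1 \<in> {0, 1}"
  shows "postcritical_set f \<subseteq> {0, 1}"
  unfolding postcritical_set_def
proof (rule closure_minimal)
  have "(poly f ^^ Suc n) z \<in> {0, 1}" if "z \<in> crit_points f" for n z
  proof (induction n)
    case 0
    then show ?case using assms(1) that by (auto simp: BP_def)
  next
    case (Suc n)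
    then show ?case using assms(2,3) by auto
  qed
  then show "(\<Union>n\<in>{n. n > 0}. (poly f ^^ n) ` crit_points f) \<subseteq> {0, 1}"
    by (auto dest!: gr0_implies_Suc) (smt (verit) insert_iff singletonD funpow.simps(2) comp_apply)+
qed simp

lemma XDBP_iff:
  "f \<in> XDBP \<longleftrightarrow> f \<in> BP \<and> poly f 0 = 0 \<and> poly f 1 = 0 \<and>
     poly (pderiv f) 0 \<noteq> 0 \<and> poly (pderiv f) 1 \<noteq> 0"
proof -
  have "local_degree f z = 1 \<longleftrightarrow> poly (pderiv f) z \<noteq> 0" if "f \<in> BP" for z
    using that by (intro local_degree_eq_1_iff) (simp add: BP_def)
  then show ?thesis
    using postcritical_set_subset[of f] unfolding XDBP_def DBP_def by blast
qed

text \<open>By the chain rule, at a critical point \<open>z\<close> of the composite either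
  \<open>poly g z\<close> is critical for \<open>f\<close>, or \<open>z\<close> is critical for
  \<open>g\<close> and its value in \<open>{0, 1}\<close> is sent to 0 by \<open>f\<close>. Over 1
  the second case is excluded, so the local degree there is that of \<open>f\<close>, namely 2. At 0
  and 1 both derivatives are nonzero because \<open>g\<close> sends these points to 0.\<close>

lemma XDBP_pcompose:
  assumes "f \<in> XDBP" "g \<in> XDBP"
  shows "f \<circ>\<^sub>p g \<in> XDBP"
proof -
  from assms have f: "f \<in> BP" "poly f 0 = 0" "poly f 1 = 0" "poly (pderiv f) 0 \<noteq> 0"
    and g: "g \<in> BP" "poly g 0 = 0" "poly g 1 = 0" "poly (pderiv g) 0 \<noteq> 0" "poly (pderiv g) 1 \<noteq> 0"
    by (simp_all add: XDBP_iff)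
  have d: "degree f \<ge> 3" "degree g \<ge> 3" using f g by (simp_all add: BP_def)
  have "degree f * degree g \<ge> 3 * 1" using d by (intro mult_mono) auto
  moreover have "poly f (poly g z) \<in> {0, 1}" if "poly (pderiv f) (poly g z) * poly (pderiv g) z = 0" for z
    using that f g by (auto simp: BP_iff)
  moreover have "poly (pderiv f) (poly g z) = 0" "poly (pderiv (pderiv f)) (poly g z) \<noteq> 0"
    "poly (pderiv g) z \<noteq> 0" if "poly f (poly g z) = 1" for z
  proof -
    show "poly (pderiv f) (poly g z) = 0" "poly (pderiv (pderiv f)) (poly g z) \<noteq> 0"
      using that f(1) by (simp_all add: BP_iff)
    have "poly g z \<notin> {0, 1}" using that f(2,3) by auto
    then show "poly (pderiv g) z \<noteq> 0" using g(1) unfolding BP_iff by blast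
  qed
  ultimately have "f \<circ>\<^sub>p g \<in> BP"
    using f(1) g(1) unfolding BP_iff
    by (auto simp: algebraic_poly_pcompose degree_pcompose pderiv_pcompose poly_pcompose pderiv_mult)
  then show ?thesis
    using f g by (simp add: XDBP_iff pderiv_pcompose poly_pcompose)
qed

text \<open>Without a critical point over 0, all \<open>d - 1\<close> critical points would be simple and lie among
  the at most \<open>d / 2\<close> points over 1.\<close>
lemma BP_critical_point_over_0:
  assumes "f \<in> BP"
  obtains z where "poly f z = 0" "poly (pderiv f) z = 0"
proof (rule ccontr)
  assume "\<not> thesis"
  with that have no: "poly f z \<noteq> 0" if "poly (pderiv f) z = 0" for z using that by blast
  let ?p = "f - [:1:]"
  let ?R = "{z. poly ?p z = 0}" and ?C = "{z. poly (pderiv f) z = 0}"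
  from assms have deg: "degree f \<ge> 3" and crit: "\<And>z. poly (pderiv f) z = 0 \<Longrightarrow> poly f z \<in> {0, 1}"
    and one: "\<And>z. poly f z = 1 \<Longrightarrow> local_degree f z = 2"
      "\<And>z. poly f z = 1 \<Longrightarrow> poly (pderiv (pderiv f)) z \<noteq> 0"
    by (auto simp: BP_iff local_degree_eq_2_iff)
  have nz: "?p \<noteq> 0" "pderiv f \<noteq> 0" using deg by (auto simp: pderiv_eq_0_iff)
  have sub: "?C \<subseteq> ?R" using crit no by auto
  have "rsquarefree (pderiv f)"
    using crit no one(2) by (auto simp: rsquarefree_roots)
  then have dec: "smult (lead_coeff (pderiv f)) (\<Prod>z\<in>?C. [:-z, 1:]) = pderiv f"
    by (rule complex_poly_decompose_rsquarefree)
  have "degree (pderiv f) = degree (\<Prod>z\<in>?C. [:-z, 1:])"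
    by (subst dec[symmetric]) (use nz in simp)
  also have "\<dots> = card ?C" by (subst degree_prod_sum_eq) auto
  finally have "degree f - 1 = card ?C" by (simp add: degree_pderiv)
  also have "\<dots> \<le> card ?R" using sub nz by (intro card_mono poly_roots_finite) auto
  \<comment> \<open>Each point over 1 counts twice as a root of \<open>?p\<close>, so
    \<open>2 * (degree f - 1) \<le> degree f\<close>, which fails from degree 3 on.\<close>
  finally have "2 * (degree f - 1) \<le> (\<Sum>z\<in>?R. 2)" by simp
  also have "\<dots> = (\<Sum>z\<in>?R. order z ?p)"
    using one(1) by (intro sum.cong) (auto simp: local_degree_def)
  also have "\<dots> \<le> degree ?p" using nz by (intro sum_order_le_degree)
  also have "\<dots> \<le> degree f" by (intro degree_diff_le) auto
  finally show False using deg by simp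
qed

subsection \<open>Uniqueness of decompositions\<close>

lemma coeff_mult_top:
  assumes "degree p \<le> m" "degree q \<le> n"
  shows "coeff (p * q) (m + n) = coeff p m * coeff q n"
proof (cases "degree p = m \<and> degree q = n")
  case True
  then show ?thesis using coeff_mult_degree_sum[of p q] by simp
next
  case False
  then have "degree p < m \<or> degree q < n" "degree p + degree q < m + n" using assms by auto
  then show ?thesis using degree_mult_le[of p q] by (auto simp: coeff_eq_0)
qed

text \<open>\<open>S\<close> is the difference quotient of \<open>r\<close> between
  \<open>u + t\<close> and \<open>u\<close>. As \<open>t\<close> has smaller degree than
  \<open>u\<close>, its top coefficient is that of \<open>pderiv r\<close> composed with
  \<open>u\<close>. The induction passes from \<open>S\<close> for \<open>r\<close> to
  \<open>r(u + t) + u S\<close> for \<open>pCons a r\<close>.\<close>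

lemma pcompose_add_diff:
  fixes r u t :: "'a::idom poly"
  assumes n: "degree t < degree u"
  obtains S where "r \<circ>\<^sub>p (u + t) - r \<circ>\<^sub>p u = t * S"
    "coeff S ((degree r - 1) * degree u) = of_nat (degree r) * lead_coeff r * lead_coeff u ^ (degree r - 1)"
proof -
  let ?n = "degree u"
  have deg: "degree (u + t) = ?n" using n by (rule degree_add_eq_left)
  have lead: "coeff (u + t) ?n = lead_coeff u" using n by (simp add: coeff_eq_0)
  \<comment> \<open>The degree bound makes the stated coefficient the top one. The case
    \<open>degree r = 0\<close> needs its own clause because \<open>degree r - 1\<close> is then
    truncated to 0, and \<open>u * S\<close> would exceed the bound unless
    \<open>S = 0\<close>.\<close>
  have "\<exists>S. r \<circ>\<^sub>p (u + t) - r \<circ>\<^sub>p u = t * S \<and> (degree r = 0 \<longrightarrow> S = 0) \<and>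
    degree S \<le> (degree r - 1) * ?n \<and>
    coeff S ((degree r - 1) * ?n) = of_nat (degree r) * lead_coeff r * lead_coeff u ^ (degree r - 1)"
  proof (induction r rule: pCons_induct)
    case 0
    show ?case by (rule exI[of _ 0]) simp
  next
    case (pCons a r)
    show ?case
    proof (cases "r = 0")
      case True
      then show ?thesis by (intro exI[of _ 0]) (simp add: pcompose_pCons)
    next
      case False
      let ?m = "degree r"
      from pCons.IH obtain S where S: "r \<circ>\<^sub>p (u + t) - r \<circ>\<^sub>p u = t * S" "?m = 0 \<longrightarrow> S = 0"
        "degree S \<le> (?m - 1) * ?n"
        "coeff S ((?m - 1) * ?n) = of_nat ?m * lead_coeff r * lead_coeff u ^ (?m - 1)"
        by (elim exE conjE) (rule that)
      let ?S = "r \<circ>\<^sub>p (u + t) + u * S"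
      have "pCons a r \<circ>\<^sub>p (u + t) - pCons a r \<circ>\<^sub>p u
          = t * (r \<circ>\<^sub>p (u + t)) + u * (r \<circ>\<^sub>p (u + t) - r \<circ>\<^sub>p u)"
        by (simp add: pcompose_pCons algebra_simps)
      then have 1: "pCons a r \<circ>\<^sub>p (u + t) - pCons a r \<circ>\<^sub>p u = t * ?S"
        unfolding S(1) by (simp add: algebra_simps)
      have d1: "degree (r \<circ>\<^sub>p (u + t)) = ?m * ?n" by (simp add: degree_pcompose deg)
      have "lead_coeff (r \<circ>\<^sub>p (u + t)) = lead_coeff r * lead_coeff u ^ ?m"
        using n deg lead by (subst lead_coeff_comp) auto
      then have c1: "coeff (r \<circ>\<^sub>p (u + t)) (?m * ?n) = lead_coeff r * lead_coeff u ^ ?m"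
        by (simp add: d1)
      have 2: "degree (u * S) \<le> ?m * ?n \<and>
        coeff (u * S) (?m * ?n) = of_nat ?m * lead_coeff r * lead_coeff u ^ ?m"
      proof (cases ?m)
        case 0
        then show ?thesis using S(2) by simp
      next
        case (Suc k)
        then show ?thesis
          using S(3,4) degree_mult_le[of u S] coeff_mult_top[of u ?n S "k * ?n"]
          by (simp add: algebra_simps)
      qed
      \<comment> \<open>The summand \<open>r(u + t)\<close> contributes the factor 1 and
        \<open>u * S\<close> the factor \<open>?m\<close>, in total the degree of
        \<open>pCons a r\<close>.\<close>
      show ?thesis
        using 1 2 d1 c1 False
        by (intro exI[of _ ?S]) (auto simp: algebra_simps intro: degree_add_le)
    qed
  qed
  then show thesis using that by blast
qed

text \<open>Two decompositions with the same degrees differ by an affine change in the middle: if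
  \<open>s = c q + t\<close> with \<open>deg t < deg q\<close>, then \<open>r(c q + t) - r(c q) = t S\<close> with \<open>S\<close> of degree at least
  \<open>(deg r - 1) deg q\<close>, while the left side equals \<open>p(q) - r(c q)\<close> and has at most that degree.\<close>
lemma pcompose_eq_pcompose_affine:
  fixes p q r s :: "'a::field_char_0 poly"
  assumes eq: "p \<circ>\<^sub>p q = r \<circ>\<^sub>p s" and "degree p = degree r" "degree q = degree s"
    "degree p > 0" "degree q > 0"
  obtains b c where "c \<noteq> 0" "s = smult c q + [:b:]" "p = r \<circ>\<^sub>p [:b, c:]"
proof -
  define m where "m = degree r"
  define n where "n = degree q"
  \<comment> \<open>With this \<open>c\<close> the top coefficients of \<open>s\<close> and
    \<open>smult c q\<close> agree, whence \<open>degree t < n\<close>.\<close>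
  define c where "c = lead_coeff s / lead_coeff q"
  define t where "t = s - smult c q"
  define r' where "r' = r \<circ>\<^sub>p [:0, c:]"
  have "q \<noteq> 0" "s \<noteq> 0" "r \<noteq> 0" using assms by auto
  then have "c \<noteq> 0" by (simp add: c_def)
  have "m > 0" "n > 0" using assms by (simp_all add: m_def n_def)
  have dt: "degree t < n"
  proof -
    have "degree t \<le> n" using assms by (auto simp: t_def n_def intro!: degree_diff_le)
    moreover have "coeff q n \<noteq> 0" using \<open>q \<noteq> 0\<close> by (simp add: n_def)
    then have "coeff t n = 0" by (simp add: t_def c_def n_def flip: assms(3))
    ultimately show ?thesis
      using \<open>n > 0\<close> by (metis degree_0 leading_coeff_0_iff order_le_less)
  qed
  have s: "s = smult c q + t" by (simp add: t_def)
  have "(smult c q) = [:0, c:] \<circ>\<^sub>p q" by (simp add: pcompose_pCons)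
  then have rcq: "r \<circ>\<^sub>p smult c q = r' \<circ>\<^sub>p q" by (simp add: r'_def pcompose_assoc)
  have dr': "degree r' = m" using \<open>c \<noteq> 0\<close> by (simp add: r'_def degree_pcompose m_def)
  \<comment> \<open>Equal leading coefficients of \<open>p\<close> and \<open>r'\<close> make
    \<open>p - r'\<close> drop below degree \<open>m\<close>, which gives the upper bound
    \<open>up\<close>.\<close>
  have "lead_coeff p * lead_coeff q ^ m = lead_coeff r * lead_coeff s ^ m"
    using arg_cong[OF eq, of lead_coeff] assms(2-5) by (simp add: lead_coeff_comp m_def)
  also have "\<dots> = lead_coeff r' * lead_coeff q ^ m"
    using \<open>c \<noteq> 0\<close> \<open>q \<noteq> 0\<close>
    by (simp add: r'_def lead_coeff_comp m_def c_def power_divide)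
  finally have "lead_coeff p = lead_coeff r'" using \<open>q \<noteq> 0\<close> by simp
  then have "coeff (p - r') m = 0" using dr' assms(2) by (simp add: m_def)
  moreover have "degree (p - r') \<le> m" using dr' assms(2) by (auto simp: m_def intro!: degree_diff_le)
  ultimately have "degree (p - r') \<le> m - 1"
    using \<open>m > 0\<close> by (metis Suc_pred' degree_0 leading_coeff_0_iff le_SucE order_le_less zero_le)
  then have up: "degree ((p - r') \<circ>\<^sub>p q) \<le> (m - 1) * n"
    by (simp add: degree_pcompose n_def)
  have "degree t < degree (smult c q)" using dt \<open>c \<noteq> 0\<close> by (simp add: n_def)
  then obtain S where S: "r \<circ>\<^sub>p (smult c q + t) - r \<circ>\<^sub>p smult c q = t * S"
    "coeff S ((degree r - 1) * degree (smult c q))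
      = of_nat (degree r) * lead_coeff r * lead_coeff (smult c q) ^ (degree r - 1)"
    by (rule pcompose_add_diff)
  have tS: "(p - r') \<circ>\<^sub>p q = t * S"
    using S(1) eq by (simp add: pcompose_diff rcq s)
  \<comment> \<open>Characteristic 0 enters here: the factor \<open>of_nat m\<close> does not
    vanish.\<close>
  have "coeff S ((m - 1) * n) \<noteq> 0"
    using S(2) \<open>c \<noteq> 0\<close> \<open>q \<noteq> 0\<close> \<open>r \<noteq> 0\<close> \<open>m > 0\<close> by (simp add: m_def n_def)
  then have "S \<noteq> 0" "degree S \<ge> (m - 1) * n" by (auto intro: le_degree)
  then have "degree t = 0"
    using up unfolding tS by (cases "t = 0") (simp_all add: degree_mult_eq)
  then obtain b where b: "t = [:b:]" using degree_eq_zeroE by blast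
  have sb: "s = smult c q + [:b:]" using s b by simp
  also have "\<dots> = [:b, c:] \<circ>\<^sub>p q" by (simp add: pcompose_pCons)
  \<comment> \<open>Composition with the nonconstant \<open>q\<close> can be cancelled on the
    right.\<close>
  finally have "(p - r \<circ>\<^sub>p [:b, c:]) \<circ>\<^sub>p q = 0" using eq by (simp add: pcompose_diff pcompose_assoc)
  then have "p = r \<circ>\<^sub>p [:b, c:]" using pcompose_eq_0 assms(5) by fastforce
  then show thesis using that \<open>c \<noteq> 0\<close> sb by blast
qed

lemma XDBP_eq_if_squares_equivalent:
  assumes f: "f \<in> XDBP" and g: "g \<in> XDBP" and "a \<noteq> 0"
    and eq: "f \<circ>\<^sub>p f = (g \<circ>\<^sub>p g) \<circ>\<^sub>p [:b, a:]"
  shows "f = g"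
proof -
  let ?h = "g \<circ>\<^sub>p [:b, a:]"
  have d: "degree f \<ge> 3" "degree g \<ge> 3" using f g by (simp_all add: XDBP_iff BP_def)
  have "degree f * degree f = degree g * degree g"
    using arg_cong[OF eq, of degree] \<open>a \<noteq> 0\<close> by (simp add: degree_pcompose)
  then have "degree f ^ 2 = degree g ^ 2" by (simp add: power2_eq_square)
  then have deg: "degree f = degree g" by simp
  have "f \<circ>\<^sub>p f = g \<circ>\<^sub>p ?h" using eq by (simp add: pcompose_assoc)
  moreover have "degree f = degree ?h" using deg \<open>a \<noteq> 0\<close> by (simp add: degree_pcompose)
  moreover have "degree f > 0" using d by simp
  \<comment> \<open>The middle affine map \<open>B\<close> is \<open>[:e, c:]\<close>; it remains to
    show \<open>c = 1\<close> and \<open>e = 0\<close>.\<close>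
  ultimately obtain e c where c: "c \<noteq> 0" and h: "?h = smult c f + [:e:]" and fg: "f = g \<circ>\<^sub>p [:e, c:]"
    using pcompose_eq_pcompose_affine[of f f g ?h] deg by blast
  have val: "poly g (b + z * a) = c * poly f z + e" for z
    using arg_cong[OF h, of "\<lambda>p. poly p z"] by (simp add: poly_pcompose)
  have der: "poly (pderiv g) (b + z * a) = c / a * poly (pderiv f) z" for z
    using arg_cong[OF h, of "\<lambda>p. poly (pderiv p) z"] \<open>a \<noteq> 0\<close>
    by (simp add: poly_pcompose pderiv_pcompose pderiv_add pderiv_smult pderiv_pCons field_simps)
  \<comment> \<open>By \<open>der\<close> the outer affine map carries critical points of
    \<open>f\<close> to critical points of \<open>g\<close>, so \<open>B\<close> sends critical
    values of \<open>f\<close> into \<open>{0, 1}\<close>.\<close>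
  have crit: "c * poly f z + e \<in> {0, 1}" if "poly (pderiv f) z = 0" for z
  proof -
    have "poly g (b + z * a) \<in> {0, 1}" using g der[of z] that by (simp add: XDBP_iff BP_iff)
    then show ?thesis unfolding val .
  qed
  \<comment> \<open>The critical values 0 and, further down, 1 have the images \<open>e\<close> and
    \<open>c + e\<close> under \<open>B\<close>.\<close>
  obtain w where "poly f w = 0" "poly (pderiv f) w = 0"
    using BP_critical_point_over_0[of f] f by (auto simp: XDBP_iff)
  then have e: "e \<in> {0, 1}" using crit[of w] by simp
  have over1: "poly (pderiv f) z = 0" if "poly f z = 1" for z
    using f that by (simp add: XDBP_iff BP_iff)
  have "\<not> constant (poly (f - [:1:]))"
    using d by (cases f) (simp add: constant_degree split: if_splits)
  then obtain v where v: "poly f v = 1"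
    using fundamental_theorem_of_algebra by fastforce
  have ce: "c + e \<in> {0, 1}" using crit[of v] over1 v by simp
  have "c + e \<noteq> 0"
  proof
    assume "c + e = 0"
    \<comment> \<open>\<open>z\<close> is the point sent to 0 by \<open>[:b, a:]\<close>. From
      \<open>poly g 0 = 0\<close> follows \<open>poly f z = 1\<close>, so \<open>z\<close> is
      critical for \<open>f\<close> and hence 0 is critical for \<open>g\<close>, a
      contradiction.\<close>
    define z where "z = - b / a"
    have z: "b + z * a = 0" using \<open>a \<noteq> 0\<close> by (simp add: z_def)
    have "c * poly f z + e = 0" using val[of z] g unfolding z by (simp add: XDBP_iff)
    moreover have "e = - c" using \<open>c + e = 0\<close> by (simp add: eq_neg_iff_add_eq_0 add.commute)
    ultimately have "c * (poly f z - 1) = 0" by (simp add: algebra_simps)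
    then have "poly (pderiv f) z = 0" using c over1 by simp
    then show False using der[of z] g by (simp add: z XDBP_iff)
  qed
  then have "c = 1" "e = 0" using ce e c by auto
  then show "f = g" using fg by (simp add: pcompose_idR)
qed

section \<open>Isomorphism classes of Belyi polynomials\<close>

lemma bp_relI:
  "f \<in> BP \<Longrightarrow> g \<in> BP \<Longrightarrow> a \<noteq> 0 \<Longrightarrow> f = g \<circ>\<^sub>p [:b, a:] \<Longrightarrow> (f, g) \<in> bp_rel"
  by (auto simp: bp_rel_def)

lemma bp_rel_equiv: "equiv BP bp_rel"
proof (rule equivI)
  show "bp_rel \<subseteq> BP \<times> BP" by (auto simp: bp_rel_def)
  show "refl_on BP bp_rel"
  proof (rule refl_onI)
    fix f assume "f \<in> BP"
    then show "(f, f) \<in> bp_rel"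
      by (intro bp_relI[of _ _ 1 0]) (simp_all add: pcompose_idR)
  qed
  show "sym bp_rel"
  proof (rule symI)
    fix f g assume "(f, g) \<in> bp_rel"
    then obtain a b where fg: "f \<in> BP" "g \<in> BP" "a \<noteq> 0" "f = g \<circ>\<^sub>p [:b, a:]"
      by (auto simp: bp_rel_def)
    have "g = f \<circ>\<^sub>p [:- b / a, 1 / a:]"
      using fg(3,4) by (simp add: pcompose_pCons pcompose_idR flip: pcompose_assoc)
    then show "(g, f) \<in> bp_rel"
      using fg(1-3) by (intro bp_relI[of _ _ "1 / a" "- b / a"]) simp_all
  qed
  show "trans bp_rel"
  proof (rule transI)
    fix f g h assume "(f, g) \<in> bp_rel" "(g, h) \<in> bp_rel"
    then obtain a b a' b' where *: "f \<in> BP" "h \<in> BP" "a \<noteq> 0" "a' \<noteq> 0"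
      "f = (h \<circ>\<^sub>p [:b', a':]) \<circ>\<^sub>p [:b, a:]"
      by (auto simp: bp_rel_def)
    then have "f = h \<circ>\<^sub>p [:b' + a' * b, a' * a:]"
      by (simp add: pcompose_pCons mult.commute flip: pcompose_assoc)
    with * show "(f, h) \<in> bp_rel"
      by (intro bp_relI[of _ _ "a' * a" "b' + a' * b"]) simp_all
  qed
qed

lemma bp_class_eq_iff:
  assumes "f \<in> BP" "g \<in> BP"
  shows "bp_class f = bp_class g \<longleftrightarrow> (f, g) \<in> bp_rel"
  using eq_equiv_class_iff[OF bp_rel_equiv assms] by (simp add: bp_class_def)

lemma bp_class_square_eq_iff:
  assumes "f \<in> XDBP" "g \<in> XDBP"
  shows "bp_class (f \<circ>\<^sub>p f) = bp_class (g \<circ>\<^sub>p g) \<longleftrightarrow> f = g"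
proof
  assume "bp_class (f \<circ>\<^sub>p f) = bp_class (g \<circ>\<^sub>p g)"
  moreover have "f \<circ>\<^sub>p f \<in> BP" "g \<circ>\<^sub>p g \<in> BP"
    using XDBP_pcompose assms by (auto simp: XDBP_iff[of "_ \<circ>\<^sub>p _"])
  ultimately have "(f \<circ>\<^sub>p f, g \<circ>\<^sub>p g) \<in> bp_rel" by (simp add: bp_class_eq_iff)
  then show "f = g" using XDBP_eq_if_squares_equivalent[OF assms] by (auto simp: bp_rel_def)
qed simp

subsection \<open>Galois action\<close>

context
  fixes \<sigma> assumes \<sigma>: "\<sigma> \<in> Gal_Qbar"
begin

lemma Gal_add: "algebraic x \<Longrightarrow> algebraic y \<Longrightarrow> \<sigma> (x + y) = \<sigma> x + \<sigma> y"
  and Gal_mult: "algebraic x \<Longrightarrow> algebraic y \<Longrightarrow> \<sigma> (x * y) = \<sigma> x * \<sigma> y"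
  and Gal_bij: "bij_betw \<sigma> {z. algebraic z} {z. algebraic z}"
  using \<sigma> by (simp_all add: Gal_Qbar_def)

lemma Gal_algebraic: "algebraic x \<Longrightarrow> algebraic (\<sigma> x)"
  using bij_betwE[OF Gal_bij] by simp

lemma Gal_inj: "algebraic x \<Longrightarrow> algebraic y \<Longrightarrow> \<sigma> x = \<sigma> y \<longleftrightarrow> x = y"
  using bij_betw_imp_inj_on[OF Gal_bij] by (auto simp: inj_on_def)

lemma Gal_surj:
  assumes "algebraic x"
  obtains w where "algebraic w" "\<sigma> w = x"
  using bij_betw_imp_surj_on[OF Gal_bij] assms by (metis imageE mem_Collect_eq)

lemma Gal_0: "\<sigma> 0 = 0"
  using Gal_add[of 0 0] by simp

lemma Gal_eq_0_iff: "algebraic x \<Longrightarrow> \<sigma> x = 0 \<longleftrightarrow> x = 0"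
  using Gal_inj[of x 0] by (simp add: Gal_0)

text \<open>The value at 1 is idempotent, and it is nonzero by injectivity.\<close>

lemma Gal_1: "\<sigma> 1 = 1"
proof -
  have "algebraic (1::complex)" by (simp add: rat_imp_algebraic)
  then show ?thesis using Gal_mult[of 1 1] Gal_eq_0_iff[of 1] by simp
qed

lemma Gal_eq_1_iff: "algebraic x \<Longrightarrow> \<sigma> x = 1 \<longleftrightarrow> x = 1"
  using Gal_inj[of x 1] by (simp add: Gal_1 rat_imp_algebraic)

lemma Gal_of_nat: "\<sigma> (of_nat n) = of_nat n"
proof (induction n)
  case (Suc n)
  then show ?case using Gal_add[of 1 "of_nat n"] by (simp add: Gal_1 rat_imp_algebraic)
qed (simp add: Gal_0)

lemma coeff_gal_poly: "coeff (gal_poly \<sigma> p) i = \<sigma> (coeff p i)"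
  by (simp add: gal_poly_def coeff_map_poly Gal_0)

lemma algebraic_gal_poly: "algebraic_poly p \<Longrightarrow> algebraic_poly (gal_poly \<sigma> p)"
  by (simp add: algebraic_poly_def coeff_gal_poly Gal_algebraic)

lemma gal_poly_pCons: "gal_poly \<sigma> (pCons a p) = pCons (\<sigma> a) (gal_poly \<sigma> p)"
  by (simp add: gal_poly_def map_poly_pCons Gal_0)

lemma degree_gal_poly: "algebraic_poly p \<Longrightarrow> degree (gal_poly \<sigma> p) = degree p"
  unfolding gal_poly_def
  by (cases "p = 0") (auto simp: algebraic_poly_def Gal_eq_0_iff intro!: map_poly_degree_eq)

lemma poly_gal_poly:
  "algebraic_poly p \<Longrightarrow> algebraic x \<Longrightarrow> poly (gal_poly \<sigma> p) (\<sigma> x) = \<sigma> (poly p x)"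
proof (induction p)
  case 0
  then show ?case by (simp add: gal_poly_def Gal_0)
next
  case (pCons a p)
  then show ?case
    by (simp add: gal_poly_pCons algebraic_poly_pCons Gal_add Gal_mult algebraic_poly_eval algebraic_mult)
qed

lemma pderiv_gal_poly: "algebraic_poly p \<Longrightarrow> pderiv (gal_poly \<sigma> p) = gal_poly \<sigma> (pderiv p)"
  by (rule poly_eqI)
    (simp add: coeff_pderiv coeff_gal_poly algebraic_poly_def Gal_mult algebraic_of_nat Gal_of_nat
      del: of_nat_Suc)

text \<open>Both sides agree at all natural numbers, which \<sigma> fixes, and two polynomials
  agreeing at infinitely many points are equal.\<close>

lemma gal_poly_pcompose:
  assumes p: "algebraic_poly p" and q: "algebraic_poly q"
  shows "gal_poly \<sigma> (p \<circ>\<^sub>p q) = gal_poly \<sigma> p \<circ>\<^sub>p gal_poly \<sigma> q" (is "?l = ?r")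
proof (rule ccontr)
  assume "?l \<noteq> ?r"
  then have "finite {x. poly (?l - ?r) x = 0}" by (intro poly_roots_finite) simp
  moreover have "range of_nat \<subseteq> {x. poly (?l - ?r) x = 0}"
  proof safe
    fix n :: nat
    have n: "algebraic (of_nat n :: complex)" by (rule algebraic_of_nat)
    have "poly ?l (\<sigma> (of_nat n)) = \<sigma> (poly p (poly q (of_nat n)))"
      using p q n by (simp add: poly_gal_poly algebraic_poly_pcompose poly_pcompose)
    also have "\<dots> = poly ?r (\<sigma> (of_nat n))"
      using p q n by (simp add: poly_gal_poly algebraic_poly_eval poly_pcompose)
    finally show "poly (?l - ?r) (of_nat n) = 0" by (simp add: Gal_of_nat)
  qed
  ultimately have "finite (range (of_nat :: nat \<Rightarrow> complex))" by (rule rev_finite_subset)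
  then show False by (simp add: range_inj_infinite inj_of_nat)
qed

text \<open>The conditions range over all complex \<open>z\<close>, while \<sigma> is controlled
  only on algebraic numbers. Critical points and points over 1 of the conjugate are algebraic, hence
  of the form \<open>\<sigma> w\<close>, and the conditions on \<open>f\<close> at \<open>w\<close>
  carry over because \<sigma> fixes 0 and 1.\<close>

lemma gal_poly_BP:
  assumes "f \<in> BP"
  shows "gal_poly \<sigma> f \<in> BP"
proof -
  from assms have alg: "algebraic_poly f" and deg: "degree f \<ge> 3" by (simp_all add: BP_iff)
  note alg' = algebraic_poly_pderiv[OF alg] algebraic_poly_pderiv[OF algebraic_poly_pderiv[OF alg]]
  have dg: "degree (gal_poly \<sigma> f) = degree f" using alg by (rule degree_gal_poly)
  have pd: "pderiv (gal_poly \<sigma> f) = gal_poly \<sigma> (pderiv f)"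
    "pderiv (gal_poly \<sigma> (pderiv f)) = gal_poly \<sigma> (pderiv (pderiv f))"
    using alg alg' by (simp_all add: pderiv_gal_poly)
  have "poly (gal_poly \<sigma> f) z \<in> {0, 1}" if z: "poly (gal_poly \<sigma> (pderiv f)) z = 0" for z
  proof -
    have "degree (gal_poly \<sigma> (pderiv f)) > 0"
      using deg alg' by (simp add: degree_gal_poly degree_pderiv)
    then have "algebraic z"
      using algebraic_poly_preimage[of "gal_poly \<sigma> (pderiv f)" z] z alg'
      by (simp add: algebraic_gal_poly)
    then obtain w where w: "algebraic w" "\<sigma> w = z" by (rule Gal_surj)
    have "poly (pderiv f) w = 0"
      using z w alg' by (auto simp: poly_gal_poly Gal_eq_0_iff algebraic_poly_eval)
    then have "poly f w \<in> {0, 1}" using assms by (simp add: BP_iff)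
    then show ?thesis using alg w poly_gal_poly[of f w] by (auto simp: Gal_0 Gal_1)
  qed
  moreover have "poly (gal_poly \<sigma> (pderiv f)) z = 0 \<and> poly (gal_poly \<sigma> (pderiv (pderiv f))) z \<noteq> 0"
    if z: "poly (gal_poly \<sigma> f) z = 1" for z
  proof -
    have "algebraic z"
      using algebraic_poly_preimage[of "gal_poly \<sigma> f" z] z alg deg dg
      by (simp add: algebraic_gal_poly rat_imp_algebraic)
    then obtain w where w: "algebraic w" "\<sigma> w = z" by (rule Gal_surj)
    have "poly f w = 1"
      using z w alg by (auto simp: poly_gal_poly Gal_eq_1_iff algebraic_poly_eval)
    then have "poly (pderiv f) w = 0" "poly (pderiv (pderiv f)) w \<noteq> 0"
      using assms by (simp_all add: BP_iff)
    then show ?thesis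
      using w alg' by (auto simp: poly_gal_poly Gal_eq_0_iff algebraic_poly_eval)
  qed
  ultimately show ?thesis
    using deg dg by (auto simp: BP_iff pd algebraic_gal_poly[OF alg])
qed

lemma gal_poly_XDBP:
  assumes "f \<in> XDBP"
  shows "gal_poly \<sigma> f \<in> XDBP"
proof -
  have f: "f \<in> BP" "poly f 0 = 0" "poly f 1 = 0" "poly (pderiv f) 0 \<noteq> 0" "poly (pderiv f) 1 \<noteq> 0"
    using assms by (simp_all add: XDBP_iff)
  from f(1) have "algebraic_poly f" by (simp add: BP_iff)
  note alg = this algebraic_poly_pderiv[OF this]
  have one: "algebraic (1::complex)" by (simp add: rat_imp_algebraic)
  have ev: "poly (gal_poly \<sigma> p) 0 = \<sigma> (poly p 0)" "poly (gal_poly \<sigma> p) 1 = \<sigma> (poly p 1)"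
    if "algebraic_poly p" for p
    using that poly_gal_poly[of p 0] poly_gal_poly[of p 1] one by (simp_all add: Gal_0 Gal_1)
  have "algebraic (poly (pderiv f) 0)" "algebraic (poly (pderiv f) 1)"
    using algebraic_poly_eval[OF alg(2)] one by simp_all
  then show ?thesis
    unfolding XDBP_iff pderiv_gal_poly[OF alg(1)] ev[OF alg(1)] ev[OF alg(2)]
    using f gal_poly_BP by (simp add: Gal_0 Gal_eq_0_iff)
qed

text \<open>An affine map relating two Belyi polynomials sends 0 and 1 to algebraic points, so \<open>\<sigma>\<close> acts
  on it.\<close>
lemma gal_poly_bp_rel:
  assumes "(f, g) \<in> bp_rel"
  shows "(gal_poly \<sigma> f, gal_poly \<sigma> g) \<in> bp_rel"
proof -
  obtain a b where fg: "f \<in> BP" "g \<in> BP" "a \<noteq> 0" "f = g \<circ>\<^sub>p [:b, a:]"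
    using assms by (auto simp: bp_rel_def)
  have alg: "algebraic_poly f" "algebraic_poly g" "degree g > 0" using fg by (auto simp: BP_iff)
  have one: "algebraic (1::complex)" by (simp add: rat_imp_algebraic)
  have "poly g b = poly f 0" "poly g (b + a) = poly f 1" using fg(4) by (simp_all add: poly_pcompose)
  then have b: "algebraic b" and ba: "algebraic (b + a)"
    using algebraic_poly_preimage[OF alg(2,3)] algebraic_poly_eval[OF alg(1)] one by simp_all
  then have a: "algebraic a" using algebraic_add[of "b + a" "- b"] by simp
  have "gal_poly \<sigma> f = gal_poly \<sigma> g \<circ>\<^sub>p gal_poly \<sigma> [:b, a:]"
    unfolding fg(4) using alg a b by (intro gal_poly_pcompose) (auto simp: algebraic_poly_pCons algebraic_poly_0)
  also have "gal_poly \<sigma> [:b, a:] = [:\<sigma> b, \<sigma> a:]"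
    by (simp add: gal_poly_pCons) (simp add: gal_poly_def)
  finally have "gal_poly \<sigma> f = gal_poly \<sigma> g \<circ>\<^sub>p [:\<sigma> b, \<sigma> a:]" .
  moreover have "\<sigma> a \<noteq> 0" using fg(3) a by (simp add: Gal_eq_0_iff)
  ultimately show ?thesis using fg(1,2) by (intro bp_relI gal_poly_BP)
qed

text \<open>Well-definedness of the action: conjugates of equivalent polynomials are equivalent, so
  the union in \<open>gal_class\<close> runs over copies of a single class.\<close>

lemma gal_class_bp_class:
  assumes "f \<in> BP"
  shows "gal_class \<sigma> (bp_class f) = bp_class (gal_poly \<sigma> f)"
proof -
  have "bp_class (gal_poly \<sigma> g) = bp_class (gal_poly \<sigma> f)" if "g \<in> bp_class f" for g
  proof -
    have "(f, g) \<in> bp_rel" using that by (simp add: bp_class_def)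
    from gal_poly_bp_rel[OF this] show ?thesis
      unfolding bp_class_def by (metis bp_rel_equiv equiv_class_eq)
  qed
  moreover have "f \<in> bp_class f"
    using equiv_class_self[OF bp_rel_equiv assms] by (simp add: bp_class_def)
  ultimately show ?thesis unfolding gal_class_def by blast
qed

end

theorem theorem3p4:
  assumes grothendieck:
    "\<And>f g. f \<in> BP \<Longrightarrow> g \<in> BP \<Longrightarrow> (dessin f \<simeq>\<^sub>D dessin g) \<longleftrightarrow> bp_class f = bp_class g"
  shows "(\<forall>f\<in>XDBP. \<forall>g\<in>XDBP. f \<circ>\<^sub>p g \<in> XDBP) \<and>
    (\<forall>f\<in>XDBP. \<forall>g\<in>XDBP. (dessin (f \<circ>\<^sub>p f) \<simeq>\<^sub>D dessin (g \<circ>\<^sub>p g)) \<longleftrightarrow> f = g) \<and>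
    (\<lambda>f. bp_class (f \<circ>\<^sub>p f)) \<in> XDBP \<rightarrow> BP // bp_rel \<and>
    inj_on (\<lambda>f. bp_class (f \<circ>\<^sub>p f)) XDBP \<and>
    (\<forall>\<sigma>\<in>Gal_Qbar. \<forall>f\<in>XDBP. gal_poly \<sigma> f \<in> XDBP \<and>
       bp_class (gal_poly \<sigma> f \<circ>\<^sub>p gal_poly \<sigma> f) = gal_class \<sigma> (bp_class (f \<circ>\<^sub>p f)))"
proof -
  have square: "f \<circ>\<^sub>p f \<in> BP" if "f \<in> XDBP" for f
    using XDBP_pcompose[OF that that] by (simp add: XDBP_iff)
  \<comment> \<open>Equivariance holds because conjugation commutes with composition.\<close>
  have "bp_class (gal_poly \<sigma> f \<circ>\<^sub>p gal_poly \<sigma> f) = gal_class \<sigma> (bp_class (f \<circ>\<^sub>p f))"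
    if "\<sigma> \<in> Gal_Qbar" "f \<in> XDBP" for \<sigma> f
  proof -
    have "algebraic_poly f" using that(2) by (simp add: XDBP_iff BP_iff)
    then show ?thesis
      using that square by (simp add: gal_class_bp_class gal_poly_pcompose)
  qed
  \<comment> \<open>The correspondence turns isomorphism of the two dessins into equality of the
    classes of the squares, which \<open>bp_class_square_eq_iff\<close> settles together with
    injectivity.\<close>
  then show ?thesis
    using square
    by (auto simp: grothendieck bp_class_square_eq_iff inj_on_def gal_poly_XDBP
        intro: XDBP_pcompose) (auto simp: bp_class_def intro: quotientI)
qed

end
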